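(* Let $m\ge2$. For all $p\ge m$ and all knot sequences $T$, the spline discrete quasi-interpolant $Q_p^*$ of degree $m$ satisfies $$\Vert Q_p^*\Vert_\infty\le\frac{m+1}{m-1}.$$ In particular the infinity norms of the $Q_p^*$ are uniformly bounded, with a bound independent of $p$ and of the sequence of knots $T$.
   Context: $T=\{t_i\}_{i\in\mathbb{Z}}$ is a strictly increasing sequence of real knots with $|t_i|\to+\infty$ as $|i|\to+\infty$. $B_i$ ($i\in\mathbb{Z}$) is the B-spline of degree $m$ with knots $t_{i-m},\ldots,t_{i+1}$ (support $[t_{i-m},t_{i+1}]$), normalized so that $\sum_iB_i=1$. Set $$\theta_i=\frac1m\sum_{r=1}^m t_{i+1-r},\qquad \theta_i^{(2)}=\frac{2}{m(m-1)}\sum_{1\le r<s\le m}t_{i+1-r}t_{i+1-s},\qquad \bar\theta_i^{(2)}=\theta_i^2-\theta_i^{(2)}.$$ The operator is $Q_p^*f=\sum_{i\in\mathbb{Z}}\lambda_i^*(f)B_i$ with $$\lambda_i^*(f)=a_i^*(-p)f(\theta_{i-p})+a_i^*(0)f(\theta_i)+a_i^*(p)f(\theta_{i+p}),$$ $$a_i^*(-p)=-\frac{\bar\theta_i^{(2)}}{(\theta_{i+p}-\theta_{i-p})(\theta_i-\theta_{i-p})},\quad a_i^*(0)=1+\frac{\bar\theta_i^{(2)}}{(\theta_{i+p}-\theta_i)(\theta_i-\theta_{i-p})},\quad a_i^*(p)=-\frac{\bar\theta_i^{(2)}}{(\theta_{i+p}-\theta_{i-p})(\theta_{i+p}-\theta_i)}.$$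 (These are the unique coefficients of this form for which $Q_p^*$ reproduces polynomials of degree at most $2$.) $\Vert Q\Vert_\infty$ is the operator norm: the supremum of $\Vert Qf\Vert_\infty$ over bounded continuous $f:\mathbb{R}\to\mathbb{R}$ with $\Vert f\Vert_\infty\le1$. *)

theory Defs
  imports "HOL-Analysis.Analysis"
begin

text \<open>The filter \<open>filtercomap abs at_top\<close> on the integers expresses \<open>|i| \<rightarrow> \<infinity>\<close>.\<close>

definition knot_sequence :: "(int \<Rightarrow> real) \<Rightarrow> bool" where
  "knot_sequence t \<longleftrightarrow>
     strict_mono t \<and> filterlim (\<lambda>i. \<bar>t i\<bar>) at_top (filtercomap abs at_top)"

text \<open>Cox--de Boor recursion, indexed so that \<open>bspline t m i\<close> has the knots
  \<open>t (i - m), \<dots>, t (i + 1)\<close>.  The half-open intervals in degree \<open>0\<close> make the B-splines of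
  every degree sum to \<open>1\<close> at every point, see \<open>bspline_partition_of_unity\<close>.\<close>

primrec bspline :: "(int \<Rightarrow> real) \<Rightarrow> nat \<Rightarrow> int \<Rightarrow> real \<Rightarrow> real" where
  "bspline t 0 i x = indicator {t i..<t (i + 1)} x"
| "bspline t (Suc k) i x =
     (x - t (i - int k - 1)) / (t i - t (i - int k - 1)) * bspline t k (i - 1) x
   + (t (i + 1) - x) / (t (i + 1) - t (i - int k)) * bspline t k i x"

definition theta :: "(int \<Rightarrow> real) \<Rightarrow> nat \<Rightarrow> int \<Rightarrow> real" where
  "theta t m i = 1 / real m * (\<Sum>r=1..m. t (i + 1 - int r))"

definition theta2 :: "(int \<Rightarrow> real) \<Rightarrow> nat \<Rightarrow> int \<Rightarrow> real" where
  "theta2 t m i = 2 / (real m * (real m - 1)) *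
     (\<Sum>(r, s)\<in>{(r, s). 1 \<le> r \<and> r < s \<and> s \<le> m}. t (i + 1 - int r) * t (i + 1 - int s))"

definition theta2_bar :: "(int \<Rightarrow> real) \<Rightarrow> nat \<Rightarrow> int \<Rightarrow> real" where
  "theta2_bar t m i = (theta t m i)\<^sup>2 - theta2 t m i"

definition coeff_left :: "(int \<Rightarrow> real) \<Rightarrow> nat \<Rightarrow> nat \<Rightarrow> int \<Rightarrow> real" where
  "coeff_left t m p i =
     - (theta2_bar t m i /
        ((theta t m (i + int p) - theta t m (i - int p)) * (theta t m i - theta t m (i - int p))))"

definition coeff_mid :: "(int \<Rightarrow> real) \<Rightarrow> nat \<Rightarrow> nat \<Rightarrow> int \<Rightarrow> real" where
  "coeff_mid t m p i =
     1 + theta2_bar t m i /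
        ((theta t m (i + int p) - theta t m i) * (theta t m i - theta t m (i - int p)))"

definition coeff_right :: "(int \<Rightarrow> real) \<Rightarrow> nat \<Rightarrow> nat \<Rightarrow> int \<Rightarrow> real" where
  "coeff_right t m p i =
     - (theta2_bar t m i /
        ((theta t m (i + int p) - theta t m (i - int p)) * (theta t m (i + int p) - theta t m i)))"

definition coeff_functional ::
    "(int \<Rightarrow> real) \<Rightarrow> nat \<Rightarrow> nat \<Rightarrow> int \<Rightarrow> (real \<Rightarrow> real) \<Rightarrow> real" where
  "coeff_functional t m p i f =
     coeff_left t m p i * f (theta t m (i - int p))
   + coeff_mid t m p i * f (theta t m i)
   + coeff_right t m p i * f (theta t m (i + int p))"

text \<open>At each point at most \<open>m + 1\<close> terms of the following sum are nonzero, see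
  \<open>bspline_outside_support\<close>.\<close>

definition quasi_interpolant ::
    "(int \<Rightarrow> real) \<Rightarrow> nat \<Rightarrow> nat \<Rightarrow> (real \<Rightarrow> real) \<Rightarrow> real \<Rightarrow> real" where
  "quasi_interpolant t m p f x = (\<Sum>\<^sub>\<infinity>i\<in>UNIV. coeff_functional t m p i f * bspline t m i x)"

text \<open>Norms are extended reals, so that an unbounded function has norm \<open>\<infinity>\<close>; the supremum of an
  unbounded set of reals would be an unspecified real.\<close>

definition sup_norm :: "(real \<Rightarrow> real) \<Rightarrow> ereal" where
  "sup_norm f = (SUP x. ereal \<bar>f x\<bar>)"

definition operator_sup_norm :: "((real \<Rightarrow> real) \<Rightarrow> (real \<Rightarrow> real)) \<Rightarrow> ereal" where
  "operator_sup_norm Q =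
     (SUP f\<in>{f. continuous_on UNIV f \<and> bounded (range f) \<and> sup_norm f \<le> 1}. sup_norm (Q f))"

lemma bspline_outside_support:
  assumes "strict_mono t" "x \<notin> {t (i - int m)..<t (i + 1)}"
  shows "bspline t m i x = 0"
  using assms(2)
proof (induction m arbitrary: i)
  case 0
  then show ?case by simp
next
  case (Suc k)
  have le: "t (i - int (Suc k)) \<le> t (i - int k)" "t i \<le> t (i + 1)"
    by (rule monoD[OF strict_mono_mono[OF assms(1)]], simp)+
  have "x \<notin> {t (i - int k)..<t (i + 1)}" "x \<notin> {t (i - 1 - int k)..<t (i - 1 + 1)}"
    using Suc.prems le by (auto simp: diff_diff_eq add.commute)
  then show ?case using Suc.IH[of i] Suc.IH[of "i - 1"] by simp
qed

lemma knot_interval_exists: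
  assumes "knot_sequence t"
  shows "\<exists>j. t j \<le> x \<and> x < t (j + 1)"
proof -
  have sm: "strict_mono t" using assms by (simp add: knot_sequence_def)
  have mono: "t i \<le> t j" if "i \<le> j" for i j
    using monoD[OF strict_mono_mono[OF sm] that] .
  have "eventually (\<lambda>i. \<bar>t i\<bar> > \<bar>x\<bar> + \<bar>t 0\<bar>) (filtercomap abs at_top)"
    using assms unfolding knot_sequence_def filterlim_at_top_dense by blast
  then obtain N where N: "\<And>i. N \<le> \<bar>i\<bar> \<Longrightarrow> \<bar>t i\<bar> > \<bar>x\<bar> + \<bar>t 0\<bar>"
    unfolding eventually_filtercomap_at_top_linorder by blast
  define M where "M = \<bar>N\<bar>"
  have M: "0 \<le> M" "N \<le> \<bar>M\<bar>" "N \<le> \<bar>- M\<bar>" by (auto simp: M_def)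
  have up: "x < t M" using N[OF M(2)] mono[of 0 M] M(1) by linarith
  have lo: "t (- M) < x" using N[OF M(3)] mono[of "- M" 0] M(1) by linarith
  define n where "n = (LEAST n. x < t (- M + int n))"
  have ex: "x < t (- M + int (nat (2 * M)))" using up by (simp add: M_def)
  have n1: "x < t (- M + int n)" unfolding n_def by (rule LeastI[of _ "nat (2 * M)"], rule ex)
  have "n \<noteq> 0" using n1 lo by (intro notI) simp
  then have "\<not> x < t (- M + int (n - 1))" unfolding n_def by (intro not_less_Least) simp
  moreover have "- M + int (n - 1) + 1 = - M + int n" using \<open>n \<noteq> 0\<close> by simp
  ultimately show ?thesis using n1 by (intro exI[of _ "- M + int (n - 1)"]) simp
qed

lemma bspline_sum_on_knot_interval:
  assumes "strict_mono t" "t j \<le> x" "x < t (j + 1)"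
  shows "(\<Sum>i=j..j + int m. bspline t m i x) = 1"
proof (induction m)
  case 0
  then show ?case using assms by simp
next
  case (Suc k)
  have mono: "t a \<le> t b" if "a \<le> b" for a b
    using monoD[OF strict_mono_mono[OF assms(1)] that] .
  define F where "F i = (x - t (i - int k)) / (t (i + 1) - t (i - int k)) * bspline t k i x" for i
  define G where "G i = (t (i + 1) - x) / (t (i + 1) - t (i - int k)) * bspline t k i x" for i
  have z1: "bspline t k (j - 1) x = 0"
    using assms by (intro bspline_outside_support) auto
  have z2: "bspline t k (j + int k + 1) x = 0"
    using assms by (intro bspline_outside_support) (auto simp: algebra_simps)
  have "(\<Sum>i=j..j + int (Suc k). bspline t (Suc k) i x)
      = (\<Sum>i=j..j + int k + 1. F (i - 1)) + (\<Sum>i=j..j + int k + 1. G i)"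
    unfolding sum.distrib[symmetric]
  proof (rule sum.cong)
    fix i
    have "i - int k - 1 = i - 1 - int k" by simp
    then show "bspline t (Suc k) i x = F (i - 1) + G i" by (simp only: bspline.simps F_def G_def diff_add_cancel)
  qed simp
  also have "(\<Sum>i=j..j + int k + 1. F (i - 1)) = (\<Sum>i=j - 1..j + int k. F i)"
    by (rule sum.reindex_bij_witness[of _ "\<lambda>i. i + 1" "\<lambda>i. i - 1"]) auto
  also have "\<dots> = (\<Sum>i=j..j + int k. F i)"
  proof (rule sum.mono_neutral_right)
    show "\<forall>i\<in>{j - 1..j + int k} - {j..j + int k}. F i = 0"
    proof
      fix i assume "i \<in> {j - 1..j + int k} - {j..j + int k}"
      then have "i = j - 1" by auto
      then show "F i = 0" using z1 by (simp add: F_def)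
    qed
  qed auto
  also have "(\<Sum>i=j..j + int k + 1. G i) = (\<Sum>i=j..j + int k. G i)"
  proof (rule sum.mono_neutral_right)
    show "\<forall>i\<in>{j..j + int k + 1} - {j..j + int k}. G i = 0"
    proof
      fix i assume "i \<in> {j..j + int k + 1} - {j..j + int k}"
      then have "i = j + int k + 1" by auto
      then show "G i = 0" using z2 by (simp add: G_def)
    qed
  qed auto
  also have "(\<Sum>i=j..j + int k. F i) + (\<Sum>i=j..j + int k. G i)
      = (\<Sum>i=j..j + int k. bspline t k i x)"
    unfolding sum.distrib[symmetric]
  proof (rule sum.cong)
    fix i
    have "t (i + 1) - t (i - int k) \<noteq> 0"
      using strict_monoD[OF assms(1), of "i - int k" "i + 1"] by simp
    moreover have "F i + G i =
        ((x - t (i - int k)) + (t (i + 1) - x)) / (t (i + 1) - t (i - int k)) * bspline t k i x"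
      by (simp only: F_def G_def add_divide_distrib distrib_right)
    ultimately show "F i + G i = bspline t k i x" by simp
  qed simp
  finally show ?case using Suc.IH by simp
qed

lemma bspline_partition_of_unity:
  assumes "knot_sequence t"
  shows "((\<lambda>i. bspline t m i x) has_sum 1) UNIV"
proof -
  have sm: "strict_mono t" using assms by (simp add: knot_sequence_def)
  have mono: "t a \<le> t b" if "a \<le> b" for a b
    using monoD[OF strict_mono_mono[OF sm] that] .
  obtain j where j: "t j \<le> x" "x < t (j + 1)" using knot_interval_exists[OF assms] by blast
  have zero: "bspline t m i x = 0" if "i \<notin> {j..j + int m}" for i
  proof (rule bspline_outside_support[OF sm])
    show "x \<notin> {t (i - int m)..<t (i + 1)}"
      using that j mono[of "i + 1" j] mono[of "j + 1" "i - int m"] by force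
  qed
  have "((\<lambda>i. bspline t m i x) has_sum 1) {j..j + int m}"
    using bspline_sum_on_knot_interval[OF sm j, of m] by (simp add: has_sum_finite_iff)
  then show ?thesis
    by (subst has_sum_cong_neutral[of "{j..j + int m}" UNIV]) (auto simp: zero)
qed

end

theory Submission
  imports Defs
begin

text \<open>Since \<open>B\<^sub>i \<ge> 0\<close> and \<open>\<Sum>\<^sub>i B\<^sub>i = 1\<close>, the norm of the operator is at most the supremum over \<open>i\<close> of
  the \<open>\<ell>\<^sup>1\<close>-norm \<open>|a\<^sub>i(-p)| + |a\<^sub>i(0)| + |a\<^sub>i(p)|\<close> of the coefficients of \<open>\<lambda>\<^sub>i\<close>.
  Write \<open>L = \<theta>\<^sub>i - \<theta>\<^sub>i\<^sub>-\<^sub>p\<close> and \<open>R = \<theta>\<^sub>i\<^sub>+\<^sub>p - \<theta>\<^sub>i\<close>, and let \<open>v\<close> be the variance of the \<open>m\<close> knots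
  \<open>t\<^sub>i\<^sub>+\<^sub>1\<^sub>-\<^sub>m, \<dots>, t\<^sub>i\<close>, whose mean is \<open>\<theta>\<^sub>i\<close>.  The number \<open>theta2_bar\<close> is equal to \<open>v / (m - 1)\<close>
  (\<open>theta2_bar_eq_variance\<close>); in particular it is nonnegative, so \<open>a\<^sub>i(0)\<close> is positive, \<open>a\<^sub>i(-p)\<close>
  and \<open>a\<^sub>i(p)\<close> are at most \<open>0\<close>, and the \<open>\<ell>\<^sup>1\<close>-norm is \<open>1 + 2 v / ((m - 1) L R)\<close>.

  The variance of numbers in \<open>[a, b]\<close> with mean \<open>\<mu>\<close> is at most \<open>(b - \<mu>) (\<mu> - a)\<close>, the
  Bhatia--Davis inequality (\<open>bhatia_davis\<close>).  Here \<open>a = t\<^sub>i\<^sub>+\<^sub>1\<^sub>-\<^sub>m\<close> and \<open>b = t\<^sub>i\<close>.  For \<open>p \<ge> m\<close> the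
  knots averaged in \<open>\<theta>\<^sub>i\<^sub>+\<^sub>p\<close> all lie to the right of \<open>b\<close> and those averaged in \<open>\<theta>\<^sub>i\<^sub>-\<^sub>p\<close> to the left
  of \<open>a\<close>, so \<open>v \<le> L R\<close>, and the \<open>\<ell>\<^sup>1\<close>-norm is at most \<open>1 + 2 / (m - 1) = (m + 1) / (m - 1)\<close>.\<close>

lemma bspline_nonneg:
  assumes "strict_mono t"
  shows "0 \<le> bspline t m i x"
proof (induction m arbitrary: i)
  case 0
  then show ?case by simp
next
  case (Suc k)
  have mono: "t a \<le> t b" if "a \<le> b" for a b
    using monoD[OF strict_mono_mono[OF assms] that] .
  have "0 \<le> (x - t (i - int k - 1)) / (t i - t (i - int k - 1)) * bspline t k (i - 1) x"
  proof (cases "x \<in> {t (i - 1 - int k)..<t (i - 1 + 1)}")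
    case True
    then show ?thesis
      using mono[of "i - int k - 1" i] Suc.IH[of "i - 1"]
      by (intro mult_nonneg_nonneg divide_nonneg_nonneg) (auto simp: algebra_simps)
  qed (simp add: bspline_outside_support[OF assms])
  moreover have "0 \<le> (t (i + 1) - x) / (t (i + 1) - t (i - int k)) * bspline t k i x"
  proof (cases "x \<in> {t (i - int k)..<t (i + 1)}")
    case True
    then show ?thesis
      using mono[of "i - int k" "i + 1"] Suc.IH[of i]
      by (intro mult_nonneg_nonneg divide_nonneg_nonneg) auto
  qed (simp add: bspline_outside_support[OF assms])
  ultimately show ?case by simp
qed

lemma square_of_sum_eq_pairs:
  fixes u :: "nat \<Rightarrow> 'a::comm_ring_1"
  shows "(\<Sum>r=1..m. u r)\<^sup>2 = (\<Sum>r=1..m. (u r)\<^sup>2)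
     + 2 * (\<Sum>(r, s)\<in>{(r, s). 1 \<le> r \<and> r < s \<and> s \<le> m}. u r * u s)"
proof (induction m)
  case 0
  have "{(r, s). 1 \<le> r \<and> r < s \<and> s \<le> (0::nat)} = {}" by auto
  then show ?case by (simp only:) simp
next
  case (Suc m)
  let ?P = "\<lambda>m::nat. {(r, s). 1 \<le> r \<and> r < s \<and> s \<le> m}"
  have fin: "finite (?P m)"
    by (rule finite_subset[of _ "{1..m} \<times> {1..m}"]) auto
  have split: "?P (Suc m) = ?P m \<union> (\<lambda>r. (r, Suc m)) ` {1..m}"
    by (auto simp: le_Suc_eq)
  have "(\<Sum>(r, s)\<in>?P (Suc m). u r * u s)
      = (\<Sum>(r, s)\<in>?P m. u r * u s) + (\<Sum>(r, s)\<in>(\<lambda>r. (r, Suc m)) ` {1..m}. u r * u s)"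
    unfolding split using fin by (intro sum.union_disjoint) auto
  also have "(\<Sum>(r, s)\<in>(\<lambda>r. (r, Suc m)) ` {1..m}. u r * u s) = (\<Sum>r=1..m. u r) * u (Suc m)"
    by (subst sum.reindex) (auto simp: inj_on_def sum_distrib_right)
  finally show ?case
    using Suc.IH by (simp add: power2_eq_square algebra_simps)
qed

text \<open>The inequality of Bhatia and Davis: expand \<open>0 \<le> \<Sum> (b - u r) (u r - a)\<close>.\<close>

lemma bhatia_davis:
  fixes u :: "'a \<Rightarrow> real"
  assumes "finite A" "A \<noteq> {}" "\<And>r. r \<in> A \<Longrightarrow> a \<le> u r" "\<And>r. r \<in> A \<Longrightarrow> u r \<le> b"
    and mean: "\<mu> = (\<Sum>r\<in>A. u r) / card A"
  shows "(\<Sum>r\<in>A. (u r - \<mu>)\<^sup>2) / card A \<le> (b - \<mu>) * (\<mu> - a)"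
proof -
  have n: "real (card A) > 0" using assms by (simp add: card_gt_0_iff)
  then have S: "(\<Sum>r\<in>A. u r) = card A * \<mu>" by (simp add: mean)
  have "0 \<le> (\<Sum>r\<in>A. (b - u r) * (u r - a))"
    using assms by (intro sum_nonneg mult_nonneg_nonneg) auto
  also have "\<dots> = (\<Sum>r\<in>A. (b - \<mu>) * (\<mu> - a) - (u r - \<mu>)\<^sup>2 + (a + b - 2 * \<mu>) * (u r - \<mu>))"
    by (intro sum.cong) (auto simp: power2_eq_square algebra_simps)
  also have "\<dots> = card A * ((b - \<mu>) * (\<mu> - a)) - (\<Sum>r\<in>A. (u r - \<mu>)\<^sup>2)
      + (a + b - 2 * \<mu>) * (\<Sum>r\<in>A. u r - \<mu>)"
    by (simp add: sum.distrib sum_subtractf[of "\<lambda>_. (b - \<mu>) * (\<mu> - a)"] sum_distrib_left)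
  also have "(\<Sum>r\<in>A. u r - \<mu>) = 0"
    by (simp add: sum_subtractf S)
  finally show ?thesis using n by (simp add: field_simps)
qed

lemma theta2_bar_eq_variance:
  assumes "m \<ge> 2"
  shows "theta2_bar t m i
    = (\<Sum>r=1..m. (t (i + 1 - int r) - theta t m i)\<^sup>2) / real m / (real m - 1)"
proof -
  define S where "S = (\<Sum>r=1..m. t (i + 1 - int r))"
  define Q where "Q = (\<Sum>r=1..m. (t (i + 1 - int r))\<^sup>2)"
  have m: "real m > 0" "real m - 1 > 0" using assms by auto
  have th: "theta t m i = S / m" by (simp add: theta_def S_def)
  have "theta2 t m i = (S\<^sup>2 - Q) / (real m * (real m - 1))"
    using square_of_sum_eq_pairs[of "\<lambda>r. t (i + 1 - int r)" m]
    by (simp add: theta2_def S_def Q_def)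
  then have "theta2_bar t m i = (S / m)\<^sup>2 - (S\<^sup>2 - Q) / (real m * (real m - 1))"
    by (simp add: theta2_bar_def th)
  also have "\<dots> = (Q - S\<^sup>2 / m) / real m / (real m - 1)"
    using m by (simp add: field_simps power2_eq_square)
  also have "Q - S\<^sup>2 / m = (\<Sum>r=1..m. (t (i + 1 - int r) - S / m)\<^sup>2)"
  proof -
    have "(\<Sum>r=1..m. (t (i + 1 - int r) - S / m)\<^sup>2)
        = (\<Sum>r=1..m. (t (i + 1 - int r))\<^sup>2 - 2 * (S / m) * t (i + 1 - int r) + (S / m)\<^sup>2)"
      by (intro sum.cong) (auto simp: power2_eq_square algebra_simps)
    also have "\<dots> = Q - 2 * (S / m) * S + m * (S / m)\<^sup>2"
      by (simp only: sum.distrib sum_subtractf sum_distrib_left[symmetric] sum_constant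
          S_def[symmetric] Q_def[symmetric]) simp
    also have "\<dots> = Q - S\<^sup>2 / m"
      using m by (simp add: field_simps power2_eq_square)
    finally show ?thesis by simp
  qed
  finally show ?thesis by (simp add: th)
qed

lemma theta_bounds:
  assumes "strict_mono t" "m \<ge> 1"
  shows "t (i + 1 - int m) \<le> theta t m i" "theta t m i \<le> t i"
proof -
  have mono: "t a \<le> t b" if "a \<le> b" for a b
    using monoD[OF strict_mono_mono[OF assms(1)] that] .
  have "real m * t (i + 1 - int m) \<le> (\<Sum>r=1..m. t (i + 1 - int r))"
    using sum_bounded_below[of "{1..m}" "t (i + 1 - int m)" "\<lambda>r. t (i + 1 - int r)"]
    by (simp add: mono)
  then show "t (i + 1 - int m) \<le> theta t m i"
    using assms(2) by (simp add: theta_def field_simps)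
  have "(\<Sum>r=1..m. t (i + 1 - int r)) \<le> real m * t i"
    using sum_bounded_above[of "{1..m}" "\<lambda>r. t (i + 1 - int r)" "t i"]
    by (simp add: mono)
  then show "theta t m i \<le> t i"
    using assms(2) by (simp add: theta_def field_simps)
qed

lemma coeff_l1_norm_le:
  assumes sm: "strict_mono t" and m: "m \<ge> 2" and p: "p \<ge> m"
  shows "\<bar>coeff_left t m p i\<bar> + \<bar>coeff_mid t m p i\<bar> + \<bar>coeff_right t m p i\<bar>
    \<le> (real m + 1) / (real m - 1)"
proof -
  define \<theta> where "\<theta> = theta t m i"
  define R where "R = theta t m (i + int p) - \<theta>"
  define L where "L = \<theta> - theta t m (i - int p)"
  define V where "V = (\<Sum>r=1..m. (t (i + 1 - int r) - \<theta>)\<^sup>2) / real m"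
  define w where "w = theta2_bar t m i"
  have mono: "t a \<le> t b" if "a \<le> b" for a b
    using monoD[OF strict_mono_mono[OF sm] that] .
  have bounds: "t (j + 1 - int m) \<le> theta t m j" "theta t m j \<le> t j" for j
    using theta_bounds[OF sm] m by auto
  have "t i < t (i + int p + 1 - int m)" "t (i - int p) < t (i + 1 - int m)"
    using p by (auto intro!: strict_monoD[OF sm])
  then have R: "t i - \<theta> < R" and L: "\<theta> - t (i + 1 - int m) < L"
    using bounds[of "i + int p"] bounds[of "i - int p"] unfolding R_def L_def by auto
  have ends: "0 \<le> t i - \<theta>" "0 \<le> \<theta> - t (i + 1 - int m)"
    using bounds[of i] by (auto simp: \<theta>_def)
  have pos: "0 < R" "0 < L" using R L ends by auto
  have "V \<le> (t i - \<theta>) * (\<theta> - t (i + 1 - int m))"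
    using bhatia_davis[of "{1..m}" "t (i + 1 - int m)" "\<lambda>r. t (i + 1 - int r)" "t i" \<theta>] m
    by (simp add: V_def \<theta>_def theta_def mono)
  also have "\<dots> \<le> R * L"
    using R L ends pos by (intro mult_mono) auto
  finally have V: "V \<le> R * L" .
  have w: "w = V / (real m - 1)"
    using theta2_bar_eq_variance[OF m, of t i] by (simp add: w_def V_def \<theta>_def)
  have w0: "0 \<le> w"
    unfolding w V_def using m by (intro divide_nonneg_nonneg sum_nonneg) auto
  have coeffs: "coeff_left t m p i = - (w / ((R + L) * L))" "coeff_mid t m p i = 1 + w / (R * L)"
    "coeff_right t m p i = - (w / ((R + L) * R))"
    by (simp_all add: coeff_left_def coeff_mid_def coeff_right_def w_def R_def L_def \<theta>_def)
  have "\<bar>coeff_left t m p i\<bar> + \<bar>coeff_mid t m p i\<bar> + \<bar>coeff_right t m p i\<bar>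
      = w / ((R + L) * L) + (1 + w / (R * L)) + w / ((R + L) * R)"
    using w0 pos by (simp add: coeffs)
  also have "w / ((R + L) * L) + (1 + w / (R * L)) + w / ((R + L) * R) = 1 + 2 * (w / (R * L))"
  proof -
    have "w / ((R + L) * L) + w / ((R + L) * R) = w * (R + L) / ((R + L) * (R * L))"
      using pos by (simp add: divide_simps) (simp add: algebra_simps)
    also have "\<dots> = w / (R * L)" using pos by simp
    finally have outer: "w / ((R + L) * L) + w / ((R + L) * R) = w / (R * L)" .
    have "a + b = c \<Longrightarrow> a + (1 + c) + b = 1 + 2 * c" for a b c :: real
      by simp
    from this[OF outer] show ?thesis .
  qed
  also have "w / (R * L) \<le> 1 / (real m - 1)"
    using divide_right_mono[OF V, of "R * L * (real m - 1)"] pos m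
    by (simp add: w mult.commute)
  also have "1 + 2 * (1 / (real m - 1)) = (real m + 1) / (real m - 1)"
    using m by (simp add: field_simps)
  finally show ?thesis by simp
qed

lemma coeff_functional_bound:
  assumes "\<And>x. \<bar>f x\<bar> \<le> 1"
  shows "\<bar>coeff_functional t m p i f\<bar>
    \<le> \<bar>coeff_left t m p i\<bar> + \<bar>coeff_mid t m p i\<bar> + \<bar>coeff_right t m p i\<bar>"
proof -
  have "\<bar>c * f x\<bar> \<le> \<bar>c\<bar>" for c x
    using mult_left_mono[OF assms, of "\<bar>c\<bar>"] by (simp add: abs_mult)
  from this[of "coeff_left t m p i" "theta t m (i - int p)"]
    this[of "coeff_mid t m p i" "theta t m i"]
    this[of "coeff_right t m p i" "theta t m (i + int p)"]
  show ?thesis unfolding coeff_functional_def by linarith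
qed

lemma quasi_interpolant_bound:
  assumes t: "knot_sequence t" and m: "m \<ge> 2" and p: "p \<ge> m" and f: "\<And>x. \<bar>f x\<bar> \<le> 1"
  shows "\<bar>quasi_interpolant t m p f x\<bar> \<le> (real m + 1) / (real m - 1)"
proof -
  let ?C = "(real m + 1) / (real m - 1)"
  have sm: "strict_mono t" using t by (simp add: knot_sequence_def)
  have major: "((\<lambda>i. ?C * bspline t m i x) has_sum ?C) UNIV"
    using has_sum_cmult_right[OF bspline_partition_of_unity[OF t, of m x], of ?C] by simp
  have term_le: "norm (coeff_functional t m p i f * bspline t m i x) \<le> ?C * bspline t m i x" for i
  proof -
    have "\<bar>coeff_functional t m p i f\<bar> \<le> ?C"
      using coeff_functional_bound[of f t m p i, OF f] coeff_l1_norm_le[OF sm m p, of i]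
      by linarith
    then show ?thesis
      unfolding real_norm_def abs_mult abs_of_nonneg[OF bspline_nonneg[OF sm]]
      by (rule mult_right_mono) (rule bspline_nonneg[OF sm])
  qed
  have "(\<lambda>i. norm (coeff_functional t m p i f * bspline t m i x)) summable_on UNIV"
    using term_le by (intro summable_on_comparison_test[OF has_sum_imp_summable[OF major]]) auto
  then have "(\<lambda>i. coeff_functional t m p i f * bspline t m i x) summable_on UNIV"
    by (rule abs_summable_summable)
  then have "norm (\<Sum>\<^sub>\<infinity>i. coeff_functional t m p i f * bspline t m i x) \<le> ?C"
    by (rule norm_infsum_le[OF has_sum_infsum major term_le])
  then show ?thesis by (simp add: quasi_interpolant_def)
qed

lemma operator_sup_norm_quasi_interpolant_le:
  assumes "knot_sequence t" "m \<ge> 2" "p \<ge> m"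
  shows "operator_sup_norm (quasi_interpolant t m p) \<le> ereal ((real m + 1) / (real m - 1))"
  unfolding operator_sup_norm_def
proof (rule SUP_least)
  fix f :: "real \<Rightarrow> real"
  assume "f \<in> {f. continuous_on UNIV f \<and> bounded (range f) \<and> sup_norm f \<le> 1}"
  then have "ereal \<bar>f x\<bar> \<le> 1" for x
    by (auto simp: sup_norm_def SUP_le_iff)
  then have "\<bar>f x\<bar> \<le> 1" for x
    by (simp add: one_ereal_def)
  then show "sup_norm (quasi_interpolant t m p f) \<le> ereal ((real m + 1) / (real m - 1))"
    unfolding sup_norm_def using quasi_interpolant_bound[OF assms]
    by (intro SUP_least) simp
qed

theorem theorem4:
  fixes m :: nat
  assumes "m \<ge> 2"
  shows "(\<forall>p t. p \<ge> m \<longrightarrow> knot_sequence t \<longrightarrow>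
            operator_sup_norm (quasi_interpolant t m p) \<le> ereal ((real m + 1) / (real m - 1)))
       \<and> (\<exists>C::real. \<forall>p t. p \<ge> m \<longrightarrow> knot_sequence t \<longrightarrow>
            operator_sup_norm (quasi_interpolant t m p) \<le> ereal C)"
  using operator_sup_norm_quasi_interpolant_le[OF _ assms] by blast

end
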